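(* Let $(\mathrm{T},\mathbb{G})$ be a graph-partitioned matrix with $\mathbb{G}=(\mathbb{V},\mathbb{E})$ acyclic and connected, $\mathrm{T}\in\mathbb{F}^{M\times N}$. Then $\mathrm{T}$ admits a TQS representation with rank-profile $$\rho_e=\operatorname{rank}\mathrm{H}_e,\qquad e\in\mathbb{E},$$ where $\mathrm{H}_e$ is the unit Hankel block of $\mathrm{T}$ associated with the edge $e$. Furthermore, such a TQS representation is minimal.
   Context: $\mathbb{F}$ is a field. $\mathbb{G}=(\mathbb{V},\mathbb{E})$ is a finite connected acyclic undirected graph (a tree) with $\mathbb{V}=\{1,\dots,K\}$. The edge set $\mathbb{E}$ is regarded as a set of ordered pairs with $(i,j)\in\mathbb{E}$ iff $(j,i)\in\mathbb{E}$ (both orientations of each edge are included; no loops). $\mathcal{N}(i)$ is the set of neighbors of $i$. Any two distinct nodes are joined by a unique (non-self-intersecting) path. Graph-partitioned matrix: each node $i$ has an input dimension $n_i\ge 0$ and an output dimension $m_i\ge 0$ (integers, zero allowed); $M=\sum_i m_i$, $N=\sum_i n_i$. A matrix $\mathrm{T}\in\mathbb{F}^{M\times N}$ is block-partitioned with blocks $\mathrm{T}\{i,j\}\in\mathbb{F}^{m_i\times n_j}$, $i,j\in\mathbb{V}$. For $\mathbb{A},\mathbb{B}\subset\mathbb{V}$, $\mathrm{T}\{\mathbb{A},\mathbb{B}\}$ is the submatrix of blocks with block-row indices in $\mathbb{A}$ and block-column indices in $\mathbb{B}$. The pair $(\mathrm{T},\mathbb{G})$ is a graph-partitioned matrix.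 TQS representation: given nonnegative integer weights $\{\rho_e\}_{e\in\mathbb{E}}$ (the rank-profile; $\rho_{(i,j)}$ and $\rho_{(j,i)}$ may differ), a TQS representation of $\mathrm{T}$ with rank-profile $\{\rho_e\}$ consists of matrices $\mathrm{D}^k\in\mathbb{F}^{m_k\times n_k}$ ($k\in\mathbb{V}$), $\mathrm{Inp}^k_j\in\mathbb{F}^{\rho_{(k,j)}\times n_k}$ ($(k,j)\in\mathbb{E}$), $\mathrm{Trans}^k_{i,j}\in\mathbb{F}^{\rho_{(k,i)}\times\rho_{(j,k)}}$ ($i\neq j$ in $\mathcal{N}(k)$), $\mathrm{Out}^k_i\in\mathbb{F}^{m_k\times\rho_{(i,k)}}$ ($(i,k)\in\mathbb{E}$) such that $\mathrm{T}\{i,i\}=\mathrm{D}^i$ and, for $i\ne j$ with unique path $j=p_0-p_1-\cdots-p_\nu=i$, $$\mathrm{T}\{i,j\}=\mathrm{Out}^i_{p_{\nu-1}}\,\mathrm{Trans}^{p_{\nu-1}}_{i,p_{\nu-2}}\cdots\mathrm{Trans}^{p_2}_{p_3,p_1}\,\mathrm{Trans}^{p_1}_{p_2,j}\,\mathrm{Inp}^j_{p_1}$$ (for $\nu=1$ this reads $\mathrm{Out}^i_j\,\mathrm{Inp}^j_i$). Minimality: a TQS representation of $\mathrm{T}$ with rank-profile $\{\rho_e\}$ is minimal if every other TQS representation of $\mathrm{T}$ (on the same $\mathbb{G}$ with the same block partition), with rank-profile $\{\rho'_e\}$, satisfies $\rho'_e\ge\rho_e$ for all $e\in\mathbb{E}$.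 Unit Hankel blocks: fix any root $r\in\mathbb{V}$, making $\mathbb{G}$ a rooted tree, and let $\mathcal{D}(i)$ be the set consisting of $i$ and all its descendants. For $(i,j)\in\mathbb{E}$ put $\mathbb{H}_{(i,j)}=\mathcal{D}(i)$ if $j$ is the parent of $i$, and $\mathbb{H}_{(i,j)}=\mathbb{V}\setminus\mathcal{D}(j)$ if $i$ is the parent of $j$. (Independently of the root, $\mathbb{H}_{(i,j)}$ is the node set of the connected component containing $i$ after removing the edge between $i$ and $j$.) With $\bar{\mathbb{H}}_{(i,j)}=\mathbb{V}\setminus\mathbb{H}_{(i,j)}$, the unit Hankel block is $\mathrm{H}_{(i,j)}=\mathrm{T}\{\bar{\mathbb{H}}_{(i,j)},\mathbb{H}_{(i,j)}\}$. *)

theory Defs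
  imports "Graph_Theory.Graph_Theory" "Jordan_Normal_Form.DL_Rank"
    "Jordan_Normal_Form.DL_Submatrix"
begin

text \<open>
  An undirected simple graph is a \<^locale>\<open>pair_graph\<close>, which stores both orientations of every
  edge. The library's \<^const>\<open>tree\<close> is too strong for such graphs: traversing an edge back and forth
  is a cycle of length 2 in the sense of \<^const>\<open>pre_digraph.cycle\<close>. A cycle of the undirected graph
  is one of length at least 3.
\<close>

definition undirected_tree :: "'v pair_pre_digraph \<Rightarrow> bool" where
  "undirected_tree G \<longleftrightarrow> pair_graph G \<and> Digraph_Component.connected (with_proj G) \<and>
     \<not> (\<exists>p. pre_digraph.cycle (with_proj G) p \<and> 3 \<le> length p)"

definition path_between :: "'v pair_pre_digraph \<Rightarrow> 'v \<Rightarrow> 'v list \<Rightarrow> 'v \<Rightarrow> bool" where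
  "path_between G u p v \<longleftrightarrow> vpath p (with_proj G) \<and> hd p = u \<and> last p = v"


text \<open>
  Nodes are numbered from 1, matrix rows and columns from 0. For block sizes \<open>d\<close>, the indices
  covered by the blocks in \<open>A\<close> are those of \<open>block_indices d A\<close>; so \<open>block_submatrix m n T A B\<close> is
  T{A,B}, where \<open>m\<close> gives the row (output) and \<open>n\<close> the column (input) dimensions.
\<close>

definition block_indices :: "(nat \<Rightarrow> nat) \<Rightarrow> nat set \<Rightarrow> nat set" where
  "block_indices d A = (\<Union>i\<in>A. {(\<Sum>l = 1..<i. d l) ..< (\<Sum>l = 1..<i. d l) + d i})"

definition block_submatrix ::
  "(nat \<Rightarrow> nat) \<Rightarrow> (nat \<Rightarrow> nat) \<Rightarrow> 'a mat \<Rightarrow> nat set \<Rightarrow> nat set \<Rightarrow> 'a mat" where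
  "block_submatrix m n T A B = submatrix T (block_indices m A) (block_indices n B)"

definition graph_partitioned_matrix ::
  "nat \<Rightarrow> nat pair_pre_digraph \<Rightarrow> (nat \<Rightarrow> nat) \<Rightarrow> (nat \<Rightarrow> nat) \<Rightarrow> 'a mat \<Rightarrow> bool" where
  "graph_partitioned_matrix K G m n T \<longleftrightarrow>
     pverts G = {1..K} \<and> T \<in> carrier_mat (\<Sum>i = 1..K. m i) (\<Sum>i = 1..K. n i)"


text \<open>
  The superscript is the first argument: \<open>Inp R k j\<close> is Inp^k_j, \<open>Trans R k i j\<close> is Trans^k_{i,j}
  (from \<open>j\<close> through \<open>k\<close> to \<open>i\<close>), and \<open>Out R k i\<close> is Out^k_i.
\<close>

record 'a tqs =
  Diag :: "nat \<Rightarrow> 'a mat"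
  Inp :: "nat \<Rightarrow> nat \<Rightarrow> 'a mat"
  Trans :: "nat \<Rightarrow> nat \<Rightarrow> nat \<Rightarrow> 'a mat"
  Out :: "nat \<Rightarrow> nat \<Rightarrow> 'a mat"

text \<open>
  On a path \<open>[p0, p1, \<dots>, p\<nu>]\<close> with \<open>\<nu> \<ge> 1\<close>, \<open>out_trans_prod\<close> is the product
  Out^{p\<nu>} Trans^{p(\<nu>-1)} \<dots> Trans^{p1} without the final factor Inp^{p0}. Lists with fewer
  than two elements do not occur.
\<close>

fun out_trans_prod :: "('a :: field) tqs \<Rightarrow> nat list \<Rightarrow> 'a mat" where
  "out_trans_prod R [j, i] = Out R i j"
| "out_trans_prod R (j # k # i # p) = out_trans_prod R (k # i # p) * Trans R k i j"

definition path_prod :: "('a :: field) tqs \<Rightarrow> nat list \<Rightarrow> 'a mat" where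
  "path_prod R p = out_trans_prod R p * Inp R (p ! 0) (p ! 1)"

definition tqs_representation ::
  "nat pair_pre_digraph \<Rightarrow> (nat \<Rightarrow> nat) \<Rightarrow> (nat \<Rightarrow> nat) \<Rightarrow> ('a :: field) mat \<Rightarrow>
   (nat \<times> nat \<Rightarrow> nat) \<Rightarrow> 'a tqs \<Rightarrow> bool" where
  "tqs_representation G m n T \<rho> R \<longleftrightarrow>
     (\<forall>k \<in> pverts G. Diag R k \<in> carrier_mat (m k) (n k)) \<and>
     (\<forall>k j. (k, j) \<in> parcs G \<longrightarrow> Inp R k j \<in> carrier_mat (\<rho> (k, j)) (n k)) \<and>
     (\<forall>k i j. (k, i) \<in> parcs G \<longrightarrow> (k, j) \<in> parcs G \<longrightarrow> i \<noteq> j \<longrightarrow>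
        Trans R k i j \<in> carrier_mat (\<rho> (k, i)) (\<rho> (j, k))) \<and>
     (\<forall>k i. (i, k) \<in> parcs G \<longrightarrow> Out R k i \<in> carrier_mat (m k) (\<rho> (i, k))) \<and>
     (\<forall>i \<in> pverts G. block_submatrix m n T {i} {i} = Diag R i) \<and>
     (\<forall>i \<in> pverts G. \<forall>j \<in> pverts G. \<forall>p. i \<noteq> j \<longrightarrow> path_between G j p i \<longrightarrow>
        block_submatrix m n T {i} {j} = path_prod R p)"

definition minimal_tqs_representation ::
  "nat pair_pre_digraph \<Rightarrow> (nat \<Rightarrow> nat) \<Rightarrow> (nat \<Rightarrow> nat) \<Rightarrow> ('a :: field) mat \<Rightarrow>
   (nat \<times> nat \<Rightarrow> nat) \<Rightarrow> 'a tqs \<Rightarrow> bool" where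
  "minimal_tqs_representation G m n T \<rho> R \<longleftrightarrow>
     tqs_representation G m n T \<rho> R \<and>
     (\<forall>\<rho>' R'. tqs_representation G m n T \<rho>' R' \<longrightarrow> (\<forall>e \<in> parcs G. \<rho> e \<le> \<rho>' e))"


text \<open>
  In the tree rooted at \<open>r\<close>, a node is a descendant of \<open>i\<close> (or \<open>i\<close> itself) if \<open>i\<close> lies on its path
  from the root, and the parent of \<open>i\<close> is the neighbour of \<open>i\<close> of which \<open>i\<close> is a descendant.
\<close>

definition descendants :: "'v pair_pre_digraph \<Rightarrow> 'v \<Rightarrow> 'v \<Rightarrow> 'v set" where
  "descendants G r i = {k. \<exists>p. path_between G r p k \<and> i \<in> set p}"

definition is_parent :: "'v pair_pre_digraph \<Rightarrow> 'v \<Rightarrow> 'v \<Rightarrow> 'v \<Rightarrow> bool" where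
  "is_parent G r j i \<longleftrightarrow> (j, i) \<in> parcs G \<and> i \<in> descendants G r j"

text \<open>Used for edges \<open>(i, j)\<close> only; there, either \<open>j\<close> is the parent of \<open>i\<close> or vice versa.\<close>

definition hankel_nodes :: "'v pair_pre_digraph \<Rightarrow> 'v \<Rightarrow> 'v \<times> 'v \<Rightarrow> 'v set" where
  "hankel_nodes G r = (\<lambda>(i, j).
     if is_parent G r j i then descendants G r i else pverts G - descendants G r j)"

definition unit_hankel_block ::
  "nat pair_pre_digraph \<Rightarrow> nat \<Rightarrow> (nat \<Rightarrow> nat) \<Rightarrow> (nat \<Rightarrow> nat) \<Rightarrow> 'a mat \<Rightarrow> nat \<times> nat \<Rightarrow> 'a mat"
where
  "unit_hankel_block G r m n T e =
     block_submatrix m n T (pverts G - hankel_nodes G r e) (hankel_nodes G r e)"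

definition mat_rank :: "('a :: field) mat \<Rightarrow> nat" where
  "mat_rank A = vec_space.rank (dim_row A) A"

end

theory Submission
  imports Defs
begin

text \<open>
  Removing an edge between \<open>a\<close> and \<open>b\<close> splits the tree into two sides, and the unit Hankel block
  of \<open>(a, b)\<close> contains the blocks of \<open>T\<close> from the side of \<open>a\<close> to the side of \<open>b\<close>, whichever root
  was used to define it (\<open>hankel_nodes_eq_side\<close>).

  \<^emph>\<open>No edge can do with less than the rank.\<close> Every path between the two sides runs through the edge.
  The matrices before the edge depend only on where the path starts, those after it only on where
  it ends. Hence any representation factors the Hankel block through a space whose dimension is its
  weight on that edge (\<open>block_factorization_across_edge\<close>), and this weight is at least the rank.

  \<^emph>\<open>The ranks suffice simultaneously for all edges.\<close> For every edge, choose columns of its Hankel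
  block that form a basis of the column space. Then \<open>T(x, z) = (\<Sum>l. T(x, y l) * g l z)\<close> for all
  entries of the block, where \<open>y\<close> enumerates the chosen columns and \<open>g\<close> gives coordinates
  (\<open>submatrix_column_basis\<close>). Let Out consist of the chosen columns and Inp of the coordinates.
  On a path through \<open>j\<close>, \<open>k\<close>, \<open>i\<close>, the side left behind grows (\<open>side_mono\<close>), so
  the basis columns chosen for \<open>(j, k)\<close> are among the columns of the Hankel block of \<open>(k, i)\<close>, and
  their coordinates there form Trans. Multiplying chosen columns by these coordinates returns the
  chosen columns of the previous edge. The product along a path therefore collapses to the chosen
  columns of the first edge, restricted to the rows of the last node, and multiplying by Inp yields
  the entries of \<open>T\<close>.
\<close>


section \<open>Rank, factorizations and bases of columns\<close>

lemma (in vec_space) maximal_indpt_columns: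
  assumes A: "A \<in> carrier_mat n nc"
  obtains S where "finite S" "maximal S (\<lambda>T. T \<subseteq> set (cols A) \<and> lin_indpt T)" "rank A = card S"
proof -
  obtain S where "finite S" "maximal S (\<lambda>T. T \<subseteq> set (cols A) \<and> lin_indpt T)"
    using maximal_exists_superset[of "set (cols A)" "\<lambda>T. T \<subseteq> set (cols A) \<and> lin_indpt T" "{}"]
      finite_lin_indpt2[of "{}"] by auto
  then show ?thesis using that rank_card_indpt[OF A] by blast
qed

text \<open>
  The columns of a product \<open>U W\<close> lie in the span of the \<open>r\<close> columns of \<open>U\<close>, so the exchange
  theorem bounds every independent set of columns by \<open>r\<close>.
\<close>

lemma mat_rank_le_if_factorization:
  fixes A :: "'a :: field mat"
  assumes A: "A \<in> carrier_mat nr nc"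
    and fac: "\<And>i j. i < nr \<Longrightarrow> j < nc \<Longrightarrow> A $$ (i, j) = (\<Sum>l<r. f i l * g l j)"
  shows "mat_rank A \<le> r"
proof -
  interpret vec_space "TYPE('a)" nr .
  obtain S where S: "finite S" "maximal S (\<lambda>T. T \<subseteq> set (cols A) \<and> lin_indpt T)"
    and "rank A = card S"
    using maximal_indpt_columns[OF A] .
  then have rank: "mat_rank A = card S" using A by (simp add: mat_rank_def)
  have sub: "S \<subseteq> set (cols A)" and indpt: "lin_indpt S"
    using S(2) by (auto simp: maximal_def)
  define ws where "ws = map (\<lambda>l. vec nr (\<lambda>i. f i l)) [0..<r]"
  have ws: "set ws \<subseteq> carrier_vec nr" by (auto simp: ws_def)
  have "v \<in> span (set ws)" if v: "v \<in> set (cols A)" for v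
  proof -
    obtain j where j: "j < nc" "v = col A j"
      using v A by (metis carrier_matD(2) cols_length cols_nth in_set_conv_nth)
    have "v = mat_of_cols nr ws *\<^sub>v vec (length ws) (\<lambda>l. g l j)"
    proof (rule eq_vecI)
      fix i assume "i < dim_vec (mat_of_cols nr ws *\<^sub>v vec (length ws) (\<lambda>l. g l j))"
      then have i: "i < nr" by simp
      show "v $ i = (mat_of_cols nr ws *\<^sub>v vec (length ws) (\<lambda>l. g l j)) $ i"
        using i j A fac[OF i j(1)]
        by (auto simp: scalar_prod_def ws_def mat_of_cols_index lessThan_atLeast0 intro!: sum.cong)
    qed (use j A in auto)
    also have "\<dots> = lincomb_list (\<lambda>l. g l j) ws"
      using lincomb_list_as_mat_mult[of ws "\<lambda>l. g l j"] ws by (auto simp: subset_iff)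
    finally show ?thesis
      using span_list_as_span[OF ws] in_span_listI by metis
  qed
  then have "S \<subseteq> span (set ws)" using sub by blast
  then obtain C :: "'a vec set" where "int (card C) \<le> int (card (set ws)) - int (card S)"
    using replacement[OF S(1) finite_set _ indpt, of ws] ws by fastforce
  then have "card S \<le> card (set ws)" by linarith
  also have "\<dots> \<le> r" using card_length[of ws] by (simp add: ws_def)
  finally show ?thesis by (simp add: rank)
qed

text \<open>
  The basis of the column space is taken among the columns themselves: a maximal independent
  subset spans all columns. Because the basis vectors are \<open>A $$ (_, y l)\<close>, they still make sense
  as columns of any larger matrix, which is what the transition matrices below exploit.
\<close>

lemma column_basis:
  fixes A :: "'a :: field mat"
  assumes A: "A \<in> carrier_mat nr nc"
  obtains y g where "\<And>l. l < mat_rank A \<Longrightarrow> y l < nc"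
    and "\<And>i j. i < nr \<Longrightarrow> j < nc \<Longrightarrow> A $$ (i, j) = (\<Sum>l<mat_rank A. A $$ (i, y l) * g l j)"
proof -
  interpret vec_space "TYPE('a)" nr .
  obtain S where S: "finite S" "maximal S (\<lambda>T. T \<subseteq> set (cols A) \<and> lin_indpt T)"
    and "rank A = card S"
    using maximal_indpt_columns[OF A] .
  then have rank: "mat_rank A = card S" using A by (simp add: mat_rank_def)
  have sub: "S \<subseteq> set (cols A)" and indpt: "lin_indpt S"
    using S(2) by (auto simp: maximal_def)
  have cols: "set (cols A) \<subseteq> carrier_vec nr" using cols_dim A by blast
  then have Sc: "S \<subseteq> carrier_vec nr" using sub by blast
  have span: "v \<in> span S" if v: "v \<in> set (cols A)" for v
  proof (rule ccontr)
    assume nin: "v \<notin> span S"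
    then have "v \<notin> S" using Sc span_mem by auto
    moreover from this nin have "lin_indpt (S \<union> {v})"
      using lin_dep_iff_in_span[OF Sc indpt, of v] v cols by auto
    ultimately show False
      using S(2) v sub unfolding maximal_def
      by (metis Un_subset_iff Un_upper1 Un_upper2 insert_subset empty_subsetI)
  qed
  obtain e where e: "bij_betw e {..<card S} S"
    using ex_bij_betw_nat_finite[OF S(1)] by (auto simp: lessThan_atLeast0)
  have "\<exists>k<nc. e l = col A k" if "l < card S" for l
  proof -
    have "e l \<in> set (cols A)" using e that sub by (auto simp: bij_betw_def)
    then show ?thesis using A by (metis carrier_matD(2) cols_length cols_nth in_set_conv_nth)
  qed
  then obtain y where y: "\<And>l. l < card S \<Longrightarrow> y l < nc \<and> e l = col A (y l)" by metis
  have "\<exists>a. lincomb a S = col A j" if "j < nc" for j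
  proof -
    have "col A j \<in> set (cols A)" using that A by (metis carrier_matD(2) cols_length cols_nth nth_mem)
    then show ?thesis using finite_in_span[OF S(1)] Sc span by auto
  qed
  then obtain a where a: "\<And>j. j < nc \<Longrightarrow> lincomb (a j) S = col A j" by metis
  show ?thesis
  proof (rule that[of y "\<lambda>l j. a j (e l)"])
    show "\<And>l. l < mat_rank A \<Longrightarrow> y l < nc" using y rank by auto
    fix i j assume i: "i < nr" and j: "j < nc"
    have "A $$ (i, j) = lincomb (a j) S $ i" using a[OF j] i j A by simp
    also have "\<dots> = (\<Sum>v\<in>S. a j v * v $ i)" by (rule lincomb_index[OF i Sc])
    also have "\<dots> = (\<Sum>l<card S. a j (e l) * e l $ i)"
      by (rule sum.reindex_bij_betw[OF e, symmetric])
    also have "\<dots> = (\<Sum>l<card S. A $$ (i, y l) * a j (e l))"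
      using y i A by (intro sum.cong) auto
    finally show "A $$ (i, j) = (\<Sum>l<mat_rank A. A $$ (i, y l) * a j (e l))" by (simp add: rank)
  qed
qed

lemma pick_mem_less:
  assumes "a < card {i. i < n \<and> i \<in> I}"
  shows "pick I a \<in> I" "pick I a < n"
proof -
  have "pick {i. i < n \<and> i \<in> I} a \<in> {i. i < n \<and> i \<in> I}"
    using assms by (intro pick_in_set) blast
  then show "pick I a \<in> I" "pick I a < n"
    unfolding pick_reduce_set[OF assms, symmetric] by blast+
qed

text \<open>
  This lemma and the next one restate the factorization bound and the column basis in the
  coordinates of the ambient matrix, so that submatrices on overlapping index sets can be compared
  without renumbering.
\<close>

lemma submatrix_rank_le_if_factorization:
  fixes A :: "'a :: field mat"
  assumes fac: "\<And>x z. x < dim_row A \<Longrightarrow> z < dim_col A \<Longrightarrow> x \<in> I \<Longrightarrow> z \<in> J \<Longrightarrow>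
    A $$ (x, z) = (\<Sum>l<r. f x l * g l z)"
  shows "mat_rank (submatrix A I J) \<le> r"
proof (rule mat_rank_le_if_factorization[OF carrier_matI[OF dim_submatrix]])
  fix a b
  assume a: "a < card {i. i < dim_row A \<and> i \<in> I}" and b: "b < card {j. j < dim_col A \<and> j \<in> J}"
  show "submatrix A I J $$ (a, b) = (\<Sum>l<r. f (pick I a) l * g l (pick J b))"
    unfolding submatrix_index[OF a b]
    by (rule fac[OF pick_mem_less(2)[OF a] pick_mem_less(2)[OF b]
      pick_mem_less(1)[OF a] pick_mem_less(1)[OF b]])
qed

lemma submatrix_column_basis:
  fixes A :: "'a :: field mat"
  obtains y g where "\<And>l. l < mat_rank (submatrix A I J) \<Longrightarrow> y l \<in> J \<and> y l < dim_col A"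
    and "\<And>x z. x < dim_row A \<Longrightarrow> z < dim_col A \<Longrightarrow> x \<in> I \<Longrightarrow> z \<in> J \<Longrightarrow>
      A $$ (x, z) = (\<Sum>l<mat_rank (submatrix A I J). A $$ (x, y l) * g l z)"
proof -
  let ?r = "mat_rank (submatrix A I J)"
  have carrier: "submatrix A I J \<in>
      carrier_mat (card {i. i < dim_row A \<and> i \<in> I}) (card {j. j < dim_col A \<and> j \<in> J})"
    by (rule carrier_matI[OF dim_submatrix])
  obtain y g where y: "\<And>l. l < ?r \<Longrightarrow> y l < card {j. j < dim_col A \<and> j \<in> J}"
    and g: "\<And>a b. a < card {i. i < dim_row A \<and> i \<in> I} \<Longrightarrow> b < card {j. j < dim_col A \<and> j \<in> J} \<Longrightarrow>
      submatrix A I J $$ (a, b) = (\<Sum>l<?r. submatrix A I J $$ (a, y l) * g l b)"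
    by (rule column_basis[OF carrier]) (rule that)
  show ?thesis
  proof (rule that[of "\<lambda>l. pick J (y l)" "\<lambda>l z. g l (card {j \<in> J. j < z})"])
    show "\<And>l. l < ?r \<Longrightarrow> pick J (y l) \<in> J \<and> pick J (y l) < dim_col A"
      using pick_mem_less[OF y] by simp
    fix x z assume *: "x < dim_row A" "z < dim_col A" "x \<in> I" "z \<in> J"
    let ?a = "card {i \<in> I. i < x}" and ?b = "card {j \<in> J. j < z}"
    have a: "?a < card {i. i < dim_row A \<and> i \<in> I}" and b: "?b < card {j. j < dim_col A \<and> j \<in> J}"
      using * by (intro psubset_card_mono; force)+
    have "A $$ (x, z) = submatrix A I J $$ (?a, ?b)" by (rule submatrix_index_card[OF *, symmetric])
    also have "\<dots> = (\<Sum>l<?r. submatrix A I J $$ (?a, y l) * g l ?b)" by (rule g[OF a b])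
    also have "\<dots> = (\<Sum>l<?r. A $$ (x, pick J (y l)) * g l ?b)"
    proof (rule sum.cong)
      fix l assume "l \<in> {..<?r}"
      then have l: "y l < card {j. j < dim_col A \<and> j \<in> J}" using y by simp
      show "submatrix A I J $$ (?a, y l) * g l ?b = A $$ (x, pick J (y l)) * g l ?b"
        unfolding submatrix_index[OF a l] pick_card_in_set[OF *(3)] ..
    qed simp
    finally show "A $$ (x, z) = (\<Sum>l<?r. A $$ (x, pick J (y l)) * g l ?b)" .
  qed
qed


section \<open>Paths in a tree\<close>

locale tree_graph = pair_graph G for G :: "'v pair_pre_digraph" +
  assumes connected: "Digraph_Component.connected (with_proj G)"
    and acyclic: "\<not> (\<exists>p. pre_digraph.cycle (with_proj G) p \<and> 3 \<le> length p)"

lemma tree_graph_iff: "tree_graph G \<longleftrightarrow> undirected_tree G"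
  by (simp add: tree_graph_def tree_graph_axioms_def undirected_tree_def)

context tree_graph
begin

abbreviation walk :: "'v list \<Rightarrow> bool" where "walk p \<equiv> vwalk p (with_proj G)"
abbreviation path :: "'v list \<Rightarrow> bool" where "path p \<equiv> vpath p (with_proj G)"

lemma arc_sym: "(u, v) \<in> parcs G \<Longrightarrow> (v, u) \<in> parcs G"
  using arcs_symmetric by blast

lemma walk_append:
  assumes "p \<noteq> []" "q \<noteq> []"
  shows "walk (p @ q) \<longleftrightarrow> walk p \<and> walk q \<and> (last p, hd q) \<in> parcs G"
  using assms by (auto simp: vwalk_def vwalk_arcs_append)

lemma path_append:
  assumes "p \<noteq> []" "q \<noteq> []"
  shows "path (p @ q) \<longleftrightarrow> path p \<and> path q \<and> (last p, hd q) \<in> parcs G \<and> set p \<inter> set q = {}"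
  using walk_append[OF assms] by (auto simp: vpath_def)

lemma path_rev: "path p \<Longrightarrow> path (rev p)"
  using vwalk_rev_ex[of "with_proj G" p] sym_arcs by (auto simp: vpath_def)

lemma path_betweenD:
  assumes "path_between G u p v"
  shows "path p" "hd p = u" "last p = v" "p \<noteq> []" "u \<in> set p" "v \<in> set p" "set p \<subseteq> pverts G"
  using assms by (auto simp: path_between_def vpath_def vwalk_def)

lemma path_between_rev: "path_between G u p v \<Longrightarrow> path_between G v (rev p) u"
  using path_rev by (auto simp: path_between_def hd_rev last_rev)

lemma path_between_append:
  assumes "path_between G u p x" "path_between G y q v" "(x, y) \<in> parcs G" "set p \<inter> set q = {}"
  shows "path_between G u (p @ q) v"
  using assms path_append[of p q] path_betweenD(4)[OF assms(1)] path_betweenD(4)[OF assms(2)]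
  by (auto simp: path_between_def)

lemma path_between_Cons:
  assumes "path_between G x p v" "(u, x) \<in> parcs G" "u \<notin> set p"
  shows "path_between G u (u # p) v"
proof -
  have "path_between G u [u] u"
    using in_arcsD1[OF assms(2)] by (auto simp: path_between_def vpath_def)
  from path_between_append[OF this assms(1,2)] assms(3) show ?thesis by simp
qed

lemma path_between_split:
  assumes "path_between G u (p @ x # q) v"
  shows "path_between G u (p @ [x]) x" "path_between G x (x # q) v"
proof -
  have "path (p @ x # q)" using assms by (simp add: path_between_def)
  moreover have "path (x # q)" if "path (p @ x # q)"
    using that path_append[of p "x # q"] by (cases p) auto
  moreover have "path (p @ [x])" if "path (p @ x # q)"
    using that path_append[of "p @ [x]" q] by (cases q) auto
  ultimately show "path_between G u (p @ [x]) x" "path_between G x (x # q) v"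
    using assms by (auto simp: path_between_def hd_append)
qed

lemma walk_imp_path_between:
  assumes "walk p"
  obtains q where "path_between G (hd p) q (last p)" "set q \<subseteq> set p"
proof
  show "path_between G (hd p) (vwalk_to_vpath p) (last p)"
    using assms
    by (simp add: path_between_def vwalk_to_vpath_vpath vwalk_to_vpath_hd vwalk_to_vpath_last)
  show "set (vwalk_to_vpath p) \<subseteq> set p" using vwalk_to_vpath_subset by auto
qed

lemma path_between_exists:
  assumes "u \<in> pverts G" "v \<in> pverts G"
  obtains p where "path_between G u p v"
proof -
  have "u \<rightarrow>\<^sup>*\<^bsub>mk_symmetric (with_proj G)\<^esub> v"
    using connected assms unfolding connected_def strongly_connected_def by auto
  then have "u \<rightarrow>\<^sup>*\<^bsub>with_proj G\<^esub> v"
    using reachable_mk_symmetric_eq by blast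
  then show ?thesis
    using that reachable_vpath_conv by (auto simp: path_between_def)
qed

lemma walk_imp_awalk:
  assumes "walk p"
  shows "awalk (hd p) (vwalk_arcs p) (last p)" "pawalk_verts (hd p) (vwalk_arcs p) = p"
  using assms
proof (induction p rule: vwalk_arcs.induct)
  case (3 x y xs)
  { case 1 with 3 show ?case by (auto simp: awalk_Cons_iff) }
  { case 2 with 3 show ?case by auto }
qed (auto simp: awalk_Nil_iff vwalk_def)

text \<open>
  A path that leads from \<open>x\<close> back to its neighbour \<open>u\<close> closes up with the edge between them to a
  cycle whose length is the number of nodes of the path; acyclicity forces that length to be 2.
\<close>

lemma path_between_adjacent:
  assumes "(u, x) \<in> parcs G" "path_between G x p u"
  shows "p = [x, u]"
proof (rule ccontr)
  assume neq: "p \<noteq> [x, u]"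
  have "u \<noteq> x" using assms(1) no_loops' by blast
  note p = path_betweenD[OF assms(2)]
  obtain y z r where r: "p = x # y # z # r"
  proof -
    obtain p' where p': "p = x # p'" using p by (cases p) auto
    with p \<open>u \<noteq> x\<close> obtain y p'' where "p' = y # p''" by (cases p') auto
    with p p' neq show thesis by (cases p'') (auto intro: that)
  qed
  have w: "walk (u # p)"
    using p assms(1) r by (simp add: vpath_def in_arcsD1)
  have "pre_digraph.cycle (with_proj G) (vwalk_arcs (u # p))"
    unfolding cycle_def using walk_imp_awalk[OF w] p r
    by (intro exI[of _ u]) (auto simp: vpath_def)
  moreover have "3 \<le> length (vwalk_arcs (u # p))" using r by simp
  ultimately show False using acyclic by blast
qed

text \<open>
  Two paths from \<open>u\<close> to \<open>v\<close> that leave \<open>u\<close> through different neighbours \<open>x\<close> and \<open>y\<close> would connect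
  \<open>x\<close> to \<open>y\<close> via \<open>v\<close> without touching \<open>u\<close>, so \<open>u\<close> could be reached from its neighbour \<open>y\<close>
  by a detour through \<open>x\<close>.
\<close>

lemma path_between_unique:
  assumes "path_between G u p v" "path_between G u q v"
  shows "p = q"
  using assms
proof (induction p arbitrary: u q)
  case Nil
  then show ?case using path_betweenD(4) by blast
next
  case (Cons a p)
  note P = path_betweenD[OF Cons.prems(1)] and Q = path_betweenD[OF Cons.prems(2)]
  have a: "a = u" using P by simp
  obtain q' where q': "q = u # q'" using Q by (cases q) auto
  show ?case
  proof (cases "p = [] \<or> q' = []")
    case True
    then show ?thesis using P Q a q' by (auto simp: vpath_def split: if_splits)
  next
    case False
    obtain x p2 where p2: "p = x # p2" using False by (cases p) auto
    obtain y q2 where q2: "q' = y # q2" using False by (cases q') auto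
    have px: "path_between G x p v" and pu: "(u, x) \<in> parcs G" "u \<notin> set p"
      using P a p2 by (auto simp: path_between_def vpath_def)
    have qy: "path_between G y q' v" and qu: "(u, y) \<in> parcs G" "u \<notin> set q'"
      using Q q' q2 by (auto simp: path_between_def vpath_def)
    have "x = y"
    proof (rule ccontr)
      assume "x \<noteq> y"
      note P' = path_betweenD[OF px] and Q' = path_betweenD[OF path_between_rev[OF qy]]
      have "walk (p \<oplus> rev q')"
        using P' Q' by (intro vwalk_joinI_vwalk) (auto simp: vpath_def)
      from walk_imp_path_between[OF this] obtain s
        where "path_between G (hd (p \<oplus> rev q')) s (last (p \<oplus> rev q'))" and s: "set s \<subseteq> set (p \<oplus> rev q')" .
      moreover have "hd (p \<oplus> rev q') = x" "last (p \<oplus> rev q') = y"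
        using P' Q' by (auto simp: vwalk_join_hd' vwalk_join_last)
      ultimately have xy: "path_between G x s y" by simp
      have "set (p \<oplus> rev q') \<subseteq> set p \<union> set q'"
        by (cases "rev q'") (auto simp: vwalk_join_def simp flip: set_rev[of q'])
      then have "u \<notin> set s" using s pu qu by auto
      then have "path_between G u (u # s) y" using path_between_Cons[OF xy pu(1)] by blast
      from path_between_adjacent[OF arc_sym[OF qu(1)] this]
      have "s = [y]" by simp
      then show False using path_betweenD(2)[OF xy] \<open>x \<noteq> y\<close> by simp
    qed
    then show ?thesis using Cons.IH[OF px] qy q' a by simp
  qed
qed

end


section \<open>The two sides of an edge\<close>

text \<open>
  For an edge between \<open>a\<close> and \<open>b\<close> of a tree, this is the component of \<open>a\<close> after removing the edge:
  a path from \<open>a\<close> that uses the edge has to visit \<open>b\<close>.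
\<close>

definition side :: "'v pair_pre_digraph \<Rightarrow> 'v \<Rightarrow> 'v \<Rightarrow> 'v set" where
  "side G a b = {y. \<exists>p. path_between G a p y \<and> b \<notin> set p}"

context tree_graph
begin

lemma path_subset_side:
  assumes "path_between G a p y" "b \<notin> set p"
  shows "set p \<subseteq> side G a b"
proof
  fix x assume "x \<in> set p"
  then obtain p1 p2 where "p = p1 @ x # p2" by (meson split_list)
  then show "x \<in> side G a b"
    using path_between_split(1)[of a p1 x p2 y] assms unfolding side_def by auto
qed

lemma side_disjoint:
  assumes "(a, b) \<in> parcs G"
  shows "side G a b \<inter> side G b a = {}"
proof (rule ccontr)
  assume "side G a b \<inter> side G b a \<noteq> {}"
  then obtain y p q where p: "path_between G a p y" "b \<notin> set p"
    and q: "path_between G b q y" "a \<notin> set q" unfolding side_def by blast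
  have "path_between G b (b # p) y" using path_between_Cons[OF p(1) arc_sym[OF assms] p(2)] .
  then have "b # p = q" using path_between_unique q(1) by blast
  then show False using q(2) path_betweenD(5)[OF p(1)] by auto
qed

lemma side_union:
  assumes "(a, b) \<in> parcs G"
  shows "side G a b \<union> side G b a = pverts G"
proof
  show "side G a b \<union> side G b a \<subseteq> pverts G"
    unfolding side_def using path_betweenD(6,7) by blast
  show "pverts G \<subseteq> side G a b \<union> side G b a"
  proof
    fix y assume "y \<in> pverts G"
    then obtain p where p: "path_between G a p y" using path_between_exists in_arcsD1[OF assms] by metis
    show "y \<in> side G a b \<union> side G b a"
    proof (cases "b \<in> set p")
      case False
      then show ?thesis using p by (auto simp: side_def)
    next
      case True
      then obtain p1 p2 where p12: "p = p1 @ b # p2" by (meson split_list)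
      have "p1 \<noteq> []" using path_betweenD(2)[OF p] p12 no_loops'[OF assms] by (cases p1) auto
      then have "a \<in> set p1" using path_betweenD(2)[OF p] p12 by (cases p1) auto
      then have "a \<notin> set (b # p2)" using path_betweenD(1)[OF p] p12 by (auto simp: vpath_def)
      then show ?thesis using path_between_split(2)[of a p1 b p2 y] p p12 by (auto simp: side_def)
    qed
  qed
qed

lemma side_complement:
  assumes "(a, b) \<in> parcs G"
  shows "pverts G - side G a b = side G b a"
  using side_disjoint[OF assms] side_union[OF assms] by blast

text \<open>
  Moving one edge further along a path enlarges the part of the tree left behind. The path from
  \<open>k\<close> to a node of \<open>side G j k\<close> leaves \<open>k\<close> through \<open>j\<close>, and it cannot meet \<open>i\<close> later since the
  only path from \<open>k\<close> to its neighbour \<open>i\<close> is the edge.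
\<close>

lemma side_mono:
  assumes "(j, k) \<in> parcs G" "(k, i) \<in> parcs G" "i \<noteq> j"
  shows "side G j k \<subseteq> side G k i"
proof
  fix y assume "y \<in> side G j k"
  then obtain p where p: "path_between G j p y" "k \<notin> set p" by (auto simp: side_def)
  have kp: "path_between G k (k # p) y" using path_between_Cons[OF p(1) arc_sym[OF assms(1)] p(2)] .
  have "i \<notin> set (k # p)"
  proof
    assume "i \<in> set (k # p)"
    then obtain p1 p2 where p12: "p = p1 @ i # p2" using no_loops'[OF assms(2)] by (auto dest: split_list)
    have "path_between G k (k # p1 @ [i]) i"
      using path_between_split(1)[of k "k # p1" i p2 y] kp p12 by simp
    from path_between_adjacent[OF arc_sym[OF assms(2)] this] have "p1 = []" by simp
    then show False using path_betweenD(2)[OF p(1)] p12 assms(3) by simp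
  qed
  then show "y \<in> side G k i" using kp by (auto simp: side_def)
qed

lemma crossing_path:
  assumes "(a, b) \<in> parcs G" "path_between G a p y" "b \<notin> set p" "path_between G b q x" "a \<notin> set q"
  shows "path_between G y (rev p @ q) x"
  using path_between_append[OF path_between_rev[OF assms(2)] assms(4,1)]
    path_subset_side[OF assms(2,3)] path_subset_side[OF assms(4,5)] side_disjoint[OF assms(1)]
  by auto

text \<open>
  The remaining lemmas of this part show that the Hankel node sets do not depend on the root: seen
  from a root beyond \<open>b\<close>, the node \<open>b\<close> is the parent of \<open>a\<close>, and the paths from the root through
  \<open>a\<close> are those that cross the edge from \<open>b\<close> to \<open>a\<close>.
\<close>

lemma descendants_eq_side:
  assumes "(a, b) \<in> parcs G" "r \<in> side G b a"
  shows "descendants G r a = side G a b"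
proof -
  obtain q where q: "path_between G b q r" "a \<notin> set q" using assms(2) by (auto simp: side_def)
  show ?thesis
  proof (rule subset_antisym; rule subsetI)
    fix k assume "k \<in> side G a b"
    then obtain p where p: "path_between G a p k" "b \<notin> set p" by (auto simp: side_def)
    have "path_between G r (rev q @ p) k"
      using crossing_path[OF arc_sym[OF assms(1)] q p] .
    then show "k \<in> descendants G r a"
      using path_betweenD(5)[OF p(1)] unfolding descendants_def by auto
  next
    fix k assume "k \<in> descendants G r a"
    then obtain p where p: "path_between G r p k" "a \<in> set p" by (auto simp: descendants_def)
    then obtain p1 p2 where p12: "p = p1 @ a # p2" by (meson split_list)
    have "path_between G a [a] a"
      using in_arcsD1[OF assms(1)] by (auto simp: path_between_def vpath_def)
    then have "path_between G r (rev q @ [a]) a"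
      using crossing_path[OF arc_sym[OF assms(1)] q, of "[a]" a] no_loops'[OF assms(1)] by simp
    moreover have "path_between G r (p1 @ [a]) a"
      using path_between_split(1)[of r p1 a p2 k] p p12 by simp
    ultimately have "p1 = rev q" using path_between_unique by blast
    then have "b \<notin> set (a # p2)"
      using path_betweenD(5)[OF q(1)] path_betweenD(1)[OF p(1)] p12 by (auto simp: vpath_def)
    then show "k \<in> side G a b"
      using path_between_split(2)[of r p1 a p2 k] p p12 by (auto simp: side_def)
  qed
qed

lemma hankel_nodes_eq_side:
  assumes "(a, b) \<in> parcs G" "r \<in> pverts G"
  shows "hankel_nodes G r (a, b) = side G a b"
proof (cases "r \<in> side G b a")
  case True
  then obtain q where q: "path_between G b q r" "a \<notin> set q" by (auto simp: side_def)
  have "path_between G a (a # q) r" using path_between_Cons[OF q(1) assms(1) q(2)] .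
  then have "path_between G r (rev (a # q)) a" by (rule path_between_rev)
  then have "a \<in> descendants G r b"
    using path_betweenD(5)[OF q(1)] unfolding descendants_def by (intro CollectI exI) auto
  then have "is_parent G r b a" using arc_sym[OF assms(1)] by (simp add: is_parent_def)
  then show ?thesis using descendants_eq_side[OF assms(1) True] by (simp add: hankel_nodes_def)
next
  case False
  then have r: "r \<in> side G a b" using side_union[OF assms(1)] assms(2) by blast
  then obtain q where q: "path_between G a q r" "b \<notin> set q" by (auto simp: side_def)
  have "a \<notin> descendants G r b"
  proof
    assume "a \<in> descendants G r b"
    then obtain p where "path_between G r p a" "b \<in> set p" by (auto simp: descendants_def)
    then show False using path_between_unique path_between_rev[OF q(1)] q(2) by (metis set_rev)
  qed
  then have "hankel_nodes G r (a, b) = pverts G - side G b a"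
    using descendants_eq_side[OF arc_sym[OF assms(1)] r] by (simp add: hankel_nodes_def is_parent_def)
  then show ?thesis using side_complement[OF arc_sym[OF assms(1)]] by simp
qed

end


section \<open>Blocks and their entries\<close>

definition offset :: "(nat \<Rightarrow> nat) \<Rightarrow> nat \<Rightarrow> nat" where
  "offset d i = (\<Sum>l = 1..<i. d l)"

lemma block_indices_offset:
  "x \<in> block_indices d A \<longleftrightarrow> (\<exists>i\<in>A. \<exists>a<d i. x = offset d i + a)"
proof -
  have "offset d i \<le> x \<and> x < offset d i + d i \<longleftrightarrow> (\<exists>a<d i. x = offset d i + a)" for i
    by (auto simp: le_iff_add)
  then show ?thesis by (auto simp: block_indices_def offset_def)
qed

lemma offset_less:
  assumes "i \<in> {1..K}" "a < d i"
  shows "offset d i + a < (\<Sum>i = 1..K. d i)"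
proof -
  have "offset d i + d i = (\<Sum>l\<in>insert i {1..<i}. d l)" by (simp add: offset_def)
  also have "\<dots> \<le> (\<Sum>l = 1..K. d l)" using assms(1) by (intro sum_mono2) auto
  finally show ?thesis using assms(2) by simp
qed

lemma pick_interval:
  assumes "a < w"
  shows "pick {s..<s + w} a = s + a"
proof -
  have "{x \<in> {s..<s + w}. x < s + a} = {s..<s + a}" using assms by auto
  then show ?thesis using pick_card_in_set[of "s + a" "{s..<s + w}"] assms by simp
qed

lemma mat_mult_eqI:
  fixes f g h :: "nat \<Rightarrow> nat \<Rightarrow> 'a :: semiring_0"
  assumes "\<And>a c. a < p \<Longrightarrow> c < s \<Longrightarrow> h a c = (\<Sum>l<q. f a l * g l c)"
  shows "mat p q (\<lambda>(a, l). f a l) * mat q s (\<lambda>(l, c). g l c) = mat p s (\<lambda>(a, c). h a c)"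
  using assms by (intro eq_matI) (simp_all add: scalar_prod_def lessThan_atLeast0)

locale partitioned_tree = tree_graph G for G :: "nat pair_pre_digraph" +
  fixes K :: nat and m n :: "nat \<Rightarrow> nat" and T :: "'a :: field mat"
  assumes partitioned: "graph_partitioned_matrix K G m n T"
begin

lemma verts_eq: "pverts G = {1..K}"
  and dim_row_eq: "dim_row T = (\<Sum>i = 1..K. m i)"
  and dim_col_eq: "dim_col T = (\<Sum>i = 1..K. n i)"
  using partitioned by (auto simp: graph_partitioned_matrix_def)

lemma block_eq_mat:
  assumes "i \<in> pverts G" "j \<in> pverts G"
  shows "block_submatrix m n T {i} {j} =
    mat (m i) (n j) (\<lambda>(a, b). T $$ (offset m i + a, offset n j + b))"
proof -
  have blk: "block_indices d {k} = {offset d k..<offset d k + d k}" for d k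
    by (simp add: block_indices_def offset_def)
  have card: "{x. x < (\<Sum>i = 1..K. d i) \<and> x \<in> {offset d k..<offset d k + d k}} =
      {offset d k..<offset d k + d k}" if k: "k \<in> {1..K}" for d k
  proof -
    have "x < (\<Sum>i = 1..K. d i)" if "x \<in> {offset d k..<offset d k + d k}" for x
      using offset_less[OF k, of "x - offset d k" d] that by auto
    then show ?thesis by blast
  qed
  show ?thesis
    unfolding block_submatrix_def submatrix_def blk dim_row_eq dim_col_eq
      card[OF assms(1)[unfolded verts_eq]] card[OF assms(2)[unfolded verts_eq]]
    by (rule cong_mat) (simp_all add: pick_interval)
qed

lemma unit_hankel_block_eq:
  assumes "(a, b) \<in> parcs G" "r \<in> pverts G"
  shows "unit_hankel_block G r m n T (a, b) = submatrix T
    (block_indices m (side G b a)) (block_indices n (side G a b))"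
  using hankel_nodes_eq_side[OF assms] side_complement[OF assms(1)]
  by (simp add: unit_hankel_block_def block_submatrix_def)


section \<open>Ranks of Hankel blocks bound every rank-profile\<close>

lemma out_trans_prod_carrier:
  assumes R: "tqs_representation G m n T \<rho> R"
    and p: "path_between G u (u # x # p) v"
  shows "out_trans_prod R (u # x # p) \<in> carrier_mat (m v) (\<rho> (u, x))"
  using p
proof (induction p arbitrary: u x)
  case Nil
  then show ?case using R by (auto simp: path_between_def vpath_def tqs_representation_def)
next
  case (Cons w p)
  have "path_between G x (x # w # p) v" and arcs: "(u, x) \<in> parcs G" "(x, w) \<in> parcs G" "w \<noteq> u"
    using Cons.prems by (auto simp: path_between_def vpath_def)
  then have "out_trans_prod R (x # w # p) \<in> carrier_mat (m v) (\<rho> (x, w))" using Cons.IH by blast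
  moreover have "Trans R x w u \<in> carrier_mat (\<rho> (x, w)) (\<rho> (u, x))"
    using R arcs arc_sym[OF arcs(1)] by (simp add: tqs_representation_def)
  ultimately show ?case by simp
qed

text \<open>
  \<open>out_trans_prod\<close> recurses from the start of the path, so the factor \<open>X\<close> that collects the
  transitions before the edge \<open>(a, b)\<close> can be split off uniformly in the rest \<open>s\<close> of the path.
\<close>

lemma out_trans_prod_factorization:
  assumes R: "tqs_representation G m n T \<rho> R"
    and "path (q @ [a, b])"
  shows "\<exists>X \<in> carrier_mat (\<rho> (a, b)) (\<rho> ((q @ [a, b]) ! 0, (q @ [a, b]) ! 1)).
    \<forall>s v. path_between G (hd (q @ [a, b])) (q @ a # b # s) v \<longrightarrow>
      out_trans_prod R (q @ a # b # s) = out_trans_prod R (a # b # s) * X"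
  using assms(2)
proof (induction q)
  case Nil
  have "out_trans_prod R (a # b # s) = out_trans_prod R (a # b # s) * 1\<^sub>m (\<rho> (a, b))"
    if "path_between G a (a # b # s) v" for s v
    using out_trans_prod_carrier[OF R that] by simp
  then show ?case by (intro bexI[of _ "1\<^sub>m (\<rho> (a, b))"]) auto
next
  case (Cons u q)
  \<comment> \<open>\<open>remdups_adj.cases\<close> distinguishes lists of length 0, 1 and at least 2.\<close>
  obtain x w r where r: "q @ [a, b] = x # w # r"
    by (cases q rule: remdups_adj.cases) auto
  have path: "path (q @ [a, b])" and arcs: "(u, x) \<in> parcs G" "(x, w) \<in> parcs G" "w \<noteq> u"
    using Cons.prems r by (auto simp: vpath_def)
  then obtain X where X: "X \<in> carrier_mat (\<rho> (a, b)) (\<rho> (x, w))"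
    and fac: "\<And>s v. path_between G x (q @ a # b # s) v \<Longrightarrow>
      out_trans_prod R (q @ a # b # s) = out_trans_prod R (a # b # s) * X"
    using Cons.IH r by auto
  have t: "Trans R x w u \<in> carrier_mat (\<rho> (x, w)) (\<rho> (u, x))"
    using R arcs arc_sym[OF arcs(1)] by (simp add: tqs_representation_def)
  have "out_trans_prod R (u # q @ a # b # s) = out_trans_prod R (a # b # s) * (X * Trans R x w u)"
    if p: "path_between G u (u # q @ a # b # s) v" for s v
  proof -
    have eq: "q @ a # b # s = x # w # r @ s" using arg_cong[OF r, of "\<lambda>l. l @ s"] by simp
    have "path_between G x (q @ a # b # s) v"
      using path_between_split(2)[of u "[u]" x "w # r @ s" v] p unfolding eq by simp
    then have 1: "out_trans_prod R (q @ a # b # s) = out_trans_prod R (a # b # s) * X" by (rule fac)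
    have "path_between G a (a # b # s) v"
      using path_between_split(2)[of u "u # q" a "b # s" v] p by simp
    then have 2: "out_trans_prod R (a # b # s) \<in> carrier_mat (m v) (\<rho> (a, b))"
      by (rule out_trans_prod_carrier[OF R])
    have "out_trans_prod R (u # q @ a # b # s) = out_trans_prod R (q @ a # b # s) * Trans R x w u"
      by (simp add: eq)
    then show ?thesis unfolding 1 using assoc_mult_mat[OF 2 X t] by simp
  qed
  then show ?case
    using X t r by (intro bexI[of _ "X * Trans R x w u"]) auto
qed

text \<open>
  Every path from \<open>side G a b\<close> to \<open>side G b a\<close> is a path into \<open>a\<close>, the edge, and a path out of
  \<open>b\<close>. The first part depends only on the input node and the last only on the output node, so all
  blocks between the two sides pass through one state space of dimension \<open>\<rho> (a, b)\<close>.
\<close>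

lemma block_factorization_across_edge:
  assumes R: "tqs_representation G m n T \<rho> R" and ab: "(a, b) \<in> parcs G"
  obtains U W where "\<And>i. i \<in> side G b a \<Longrightarrow> U i \<in> carrier_mat (m i) (\<rho> (a, b))"
    and "\<And>j. j \<in> side G a b \<Longrightarrow> W j \<in> carrier_mat (\<rho> (a, b)) (n j)"
    and "\<And>i j. i \<in> side G b a \<Longrightarrow> j \<in> side G a b \<Longrightarrow> block_submatrix m n T {i} {j} = U i * W j"
proof -
  have "\<exists>q. path_between G b q i \<and> a \<notin> set q" if "i \<in> side G b a" for i
    using that by (simp add: side_def)
  then obtain q where q: "\<And>i. i \<in> side G b a \<Longrightarrow> path_between G b (q i) i \<and> a \<notin> set (q i)" by metis
  define U where "U i = out_trans_prod R (a # q i)" for i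
  have q_Cons: "\<exists>s. q i = b # s" if "i \<in> side G b a" for i
    using path_betweenD[of b "q i" i] q[OF that] by (cases "q i") auto
  have "\<exists>Ij \<in> carrier_mat (\<rho> (a, b)) (n j). \<forall>i \<in> side G b a. block_submatrix m n T {i} {j} = U i * Ij"
    if j: "j \<in> side G a b" for j
  proof -
    obtain p where p: "path_between G a p j" "b \<notin> set p" using j by (auto simp: side_def)
    obtain p' where p': "rev p = p' @ [a]"
      using path_betweenD[OF p(1)] by (cases p) auto
    \<comment> \<open>The node after \<open>j\<close>, which selects the matrix Inp, is \<open>b\<close> itself when \<open>j = a\<close>; extending the
      path up to \<open>b\<close> makes it available in all cases.\<close>
    have bb: "path_between G b [b] b"
      using in_arcsD2[OF ab] by (auto simp: path_between_def vpath_def)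
    have pab: "path_between G j (p' @ [a, b]) b"
      using crossing_path[OF ab p bb] p' no_loops'[OF ab] by simp
    let ?k = "(p' @ [a, b]) ! 1"
    have j0: "(p' @ [a, b]) ! 0 = j" and hd: "hd (p' @ [a, b]) = j"
      using path_betweenD[OF pab] by (cases p'; simp)+
    have jk: "(j, ?k) \<in> parcs G"
      using path_betweenD[OF pab] by (cases p' rule: remdups_adj.cases) (auto simp: vpath_def)
    obtain X where X: "X \<in> carrier_mat (\<rho> (a, b)) (\<rho> (j, ?k))"
      and fac: "\<And>s v. path_between G j (p' @ a # b # s) v \<Longrightarrow>
        out_trans_prod R (p' @ a # b # s) = out_trans_prod R (a # b # s) * X"
      using out_trans_prod_factorization[OF R path_betweenD(1)[OF pab]] j0 hd by auto
    have inp: "Inp R j ?k \<in> carrier_mat (\<rho> (j, ?k)) (n j)"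
      using R jk by (simp add: tqs_representation_def)
    have "block_submatrix m n T {i} {j} = U i * (X * Inp R j ?k)" if i: "i \<in> side G b a" for i
    proof -
      obtain s where s: "q i = b # s" using q_Cons[OF i] by blast
      have path: "path_between G j (p' @ a # b # s) i"
        using crossing_path[OF ab p] q[OF i] p' s by simp
      have "path_between G a (a # b # s) i"
        using path_between_split(2)[OF path] .
      then have c: "out_trans_prod R (a # b # s) \<in> carrier_mat (m i) (\<rho> (a, b))"
        by (rule out_trans_prod_carrier[OF R])
      have "i \<noteq> j" "i \<in> pverts G" "j \<in> pverts G"
        using i j side_disjoint[OF ab] side_union[OF ab] by blast+
      then have "block_submatrix m n T {i} {j} = path_prod R (p' @ a # b # s)"
        using R path unfolding tqs_representation_def by blast
      also have "\<dots> = out_trans_prod R (a # b # s) * X * Inp R j ?k"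
      proof -
        have "(p' @ a # b # s) ! 0 = j" "(p' @ a # b # s) ! 1 = ?k"
          using j0 by (auto simp: nth_append nth_Cons')
        then show ?thesis unfolding path_prod_def fac[OF path] by simp
      qed
      finally show ?thesis using assoc_mult_mat[OF c X inp] by (simp add: U_def s)
    qed
    then show ?thesis using X inp by (intro bexI[of _ "X * Inp R j ?k"]) auto
  qed
  then obtain W where W: "\<And>j. j \<in> side G a b \<Longrightarrow> W j \<in> carrier_mat (\<rho> (a, b)) (n j) \<and>
      (\<forall>i \<in> side G b a. block_submatrix m n T {i} {j} = U i * W j)" by metis
  show ?thesis
  proof (rule that[of U W])
    fix i assume i: "i \<in> side G b a"
    then obtain s where s: "q i = b # s" using q_Cons by blast
    have "path_between G a (a # b # s) i"
      using path_between_Cons[of b "b # s" i a] q[OF i] ab s by simp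
    then show "U i \<in> carrier_mat (m i) (\<rho> (a, b))"
      using out_trans_prod_carrier[OF R] by (simp add: U_def s)
  qed (use W in auto)
qed

lemma rank_unit_hankel_block_le:
  assumes r: "r \<in> pverts G" and ab: "(a, b) \<in> parcs G"
    and R: "tqs_representation G m n T \<rho> R"
  shows "mat_rank (unit_hankel_block G r m n T (a, b)) \<le> \<rho> (a, b)"
proof -
  obtain U W where U: "\<And>i. i \<in> side G b a \<Longrightarrow> U i \<in> carrier_mat (m i) (\<rho> (a, b))"
    and W: "\<And>j. j \<in> side G a b \<Longrightarrow> W j \<in> carrier_mat (\<rho> (a, b)) (n j)"
    and UW: "\<And>i j. i \<in> side G b a \<Longrightarrow> j \<in> side G a b \<Longrightarrow> block_submatrix m n T {i} {j} = U i * W j"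
    using block_factorization_across_edge[OF R ab] by metis
  \<comment> \<open>Each row and each column of the Hankel block is split into a node and a position within the
    block of that node.\<close>
  have "\<forall>x. \<exists>i a'. x \<in> block_indices m (side G b a) \<longrightarrow> i \<in> side G b a \<and> a' < m i \<and> x = offset m i + a'"
    by (auto simp: block_indices_offset)
  then obtain ri ra where row: "\<And>x. x \<in> block_indices m (side G b a) \<Longrightarrow>
      ri x \<in> side G b a \<and> ra x < m (ri x) \<and> x = offset m (ri x) + ra x" by metis
  have "\<forall>z. \<exists>j b'. z \<in> block_indices n (side G a b) \<longrightarrow> j \<in> side G a b \<and> b' < n j \<and> z = offset n j + b'"
    by (auto simp: block_indices_offset)
  then obtain ci cb where col: "\<And>z. z \<in> block_indices n (side G a b) \<Longrightarrow>
      ci z \<in> side G a b \<and> cb z < n (ci z) \<and> z = offset n (ci z) + cb z" by metis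
  show ?thesis unfolding unit_hankel_block_eq[OF ab r]
  proof (rule submatrix_rank_le_if_factorization)
    fix x z
    assume x: "x \<in> block_indices m (side G b a)" and z: "z \<in> block_indices n (side G a b)"
    note x' = row[OF x] and z' = col[OF z]
    have verts: "ri x \<in> pverts G" "ci z \<in> pverts G" using x' z' side_union[OF ab] by auto
    have "T $$ (x, z) = block_submatrix m n T {ri x} {ci z} $$ (ra x, cb z)"
      unfolding block_eq_mat[OF verts] using x' z' by simp
    also have "\<dots> = (U (ri x) * W (ci z)) $$ (ra x, cb z)" using UW x' z' by simp
    also have "\<dots> = (\<Sum>l<\<rho> (a, b). U (ri x) $$ (ra x, l) * W (ci z) $$ (l, cb z))"
      using U[of "ri x"] W[of "ci z"] x' z' by (auto simp: scalar_prod_def lessThan_atLeast0 intro!: sum.cong)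
    finally show "T $$ (x, z) = (\<Sum>l<\<rho> (a, b). U (ri x) $$ (ra x, l) * W (ci z) $$ (l, cb z))" .
  qed
qed


section \<open>A representation attaining the ranks\<close>

text \<open>
  The state on an edge \<open>(a, b)\<close> consists of coordinates with respect to a basis of columns
  \<open>y a b\<close> of the Hankel block, and \<open>g a b\<close> are the coordinates of the other columns. Outputs are
  read off the basis columns; \<open>Trans R k i j\<close> has as its columns the coordinates of the basis
  columns of \<open>(j, k)\<close> with respect to those of \<open>(k, i)\<close>. These coordinates exist by
  \<open>side_mono\<close>, and they make the product along a path telescope.
\<close>

lemma tqs_representation_exists:
  assumes r: "r \<in> pverts G"
    and \<rho>: "\<And>e. e \<in> parcs G \<Longrightarrow> \<rho> e = mat_rank (unit_hankel_block G r m n T e)"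
  shows "\<exists>R. tqs_representation G m n T \<rho> R"
proof -
  define basis where "basis a b y g \<longleftrightarrow>
      (\<forall>l < \<rho> (a, b). y l \<in> block_indices n (side G a b) \<and> y l < dim_col T) \<and>
      (\<forall>x z. x < dim_row T \<longrightarrow> z < dim_col T \<longrightarrow> x \<in> block_indices m (side G b a) \<longrightarrow>
        z \<in> block_indices n (side G a b) \<longrightarrow> T $$ (x, z) = (\<Sum>l<\<rho> (a, b). T $$ (x, y l) * g l z))"
    for a b y g
  have "\<exists>y g. basis a b y g" if ab: "(a, b) \<in> parcs G" for a b
  proof -
    have rank: "mat_rank (submatrix T (block_indices m (side G b a)) (block_indices n (side G a b))) =
        \<rho> (a, b)"
      using \<rho>[OF ab] unit_hankel_block_eq[OF ab r] by simp
    obtain y g where "\<And>l. l < \<rho> (a, b) \<Longrightarrow> y l \<in> block_indices n (side G a b) \<and> y l < dim_col T"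
      and "\<And>x z. x < dim_row T \<Longrightarrow> z < dim_col T \<Longrightarrow> x \<in> block_indices m (side G b a) \<Longrightarrow>
        z \<in> block_indices n (side G a b) \<Longrightarrow> T $$ (x, z) = (\<Sum>l<\<rho> (a, b). T $$ (x, y l) * g l z)"
      by (rule submatrix_column_basis[of T "block_indices m (side G b a)"
        "block_indices n (side G a b)", unfolded rank]) (rule that)
    then have "basis a b y g" unfolding basis_def by blast
    then show ?thesis by blast
  qed
  then obtain y g where "\<And>a b. (a, b) \<in> parcs G \<Longrightarrow> basis a b (y a b) (g a b)" by metis
  then have
    y: "\<And>a b l. (a, b) \<in> parcs G \<Longrightarrow> l < \<rho> (a, b) \<Longrightarrow>
      y a b l \<in> block_indices n (side G a b) \<and> y a b l < dim_col T" and
    g: "\<And>a b x z. (a, b) \<in> parcs G \<Longrightarrow> x < dim_row T \<Longrightarrow> z < dim_col T \<Longrightarrow>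
      x \<in> block_indices m (side G b a) \<Longrightarrow> z \<in> block_indices n (side G a b) \<Longrightarrow>
      T $$ (x, z) = (\<Sum>l<\<rho> (a, b). T $$ (x, y a b l) * g a b l z)"
    unfolding basis_def by blast+
  define R where "R = \<lparr>Diag = \<lambda>k. block_submatrix m n T {k} {k},
    Inp = \<lambda>k j. mat (\<rho> (k, j)) (n k) (\<lambda>(l, b). g k j l (offset n k + b)),
    Trans = \<lambda>k i j. mat (\<rho> (k, i)) (\<rho> (j, k)) (\<lambda>(l, l'). g k i l (y j k l')),
    Out = \<lambda>k i. mat (m k) (\<rho> (i, k)) (\<lambda>(a, l). T $$ (offset m k + a, y i k l))\<rparr>"
  have end_in_side: "v \<in> side G x u" if "path_between G u (u # x # p) v" for u x p v
    using path_between_split(2)[of u "[u]" x p v] that by (auto simp: side_def path_between_def vpath_def)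
  \<comment> \<open>Each transition rewrites basis columns of one edge as basis columns of the preceding one, so
    only the first edge of the path remains visible in the product.\<close>
  have out: "out_trans_prod R (u # x # p) =
      mat (m v) (\<rho> (u, x)) (\<lambda>(a, l). T $$ (offset m v + a, y u x l))"
    if "path_between G u (u # x # p) v" for u x p v
    using that
  proof (induction p arbitrary: u x)
    case Nil
    then show ?case by (simp add: R_def path_between_def)
  next
    case (Cons w p)
    have path: "path_between G x (x # w # p) v"
      and ux: "(u, x) \<in> parcs G" and xw: "(x, w) \<in> parcs G" and "w \<noteq> u"
      using Cons.prems by (auto simp: path_between_def vpath_def)
    have v: "v \<in> pverts G" using path_betweenD[OF path] by blast
    have "out_trans_prod R (u # x # w # p) =
        mat (m v) (\<rho> (x, w)) (\<lambda>(a, l). T $$ (offset m v + a, y x w l)) *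
        mat (\<rho> (x, w)) (\<rho> (u, x)) (\<lambda>(l, l'). g x w l (y u x l'))"
      using Cons.IH[OF path] by (simp add: R_def)
    also have "\<dots> = mat (m v) (\<rho> (u, x)) (\<lambda>(a, l). T $$ (offset m v + a, y u x l))"
    proof (rule mat_mult_eqI)
      fix a l assume a: "a < m v" and l: "l < \<rho> (u, x)"
      show "T $$ (offset m v + a, y u x l) =
          (\<Sum>l'<\<rho> (x, w). T $$ (offset m v + a, y x w l') * g x w l' (y u x l))"
      proof (rule g[OF xw])
        show "offset m v + a < dim_row T"
          using offset_less[of v K a m] v a by (simp add: verts_eq dim_row_eq)
        show "y u x l < dim_col T" using y[OF ux l] by blast
        show "offset m v + a \<in> block_indices m (side G w x)"
          using end_in_side[OF path] a by (auto simp: block_indices_offset)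
        show "y u x l \<in> block_indices n (side G x w)"
          using y[OF ux l] side_mono[OF ux xw \<open>w \<noteq> u\<close>] by (auto simp: block_indices_def)
      qed
    qed
    finally show ?case .
  qed
  have "block_submatrix m n T {i} {j} = path_prod R p"
    if i: "i \<in> pverts G" and j: "j \<in> pverts G" and "i \<noteq> j" and p: "path_between G j p i" for i j p
  proof -
    obtain k p' where p': "p = j # k # p'"
      using path_betweenD[OF p] \<open>i \<noteq> j\<close> by (cases p rule: remdups_adj.cases) auto
    have jk: "(j, k) \<in> parcs G" using p p' by (auto simp: path_between_def vpath_def)
    have "j \<in> side G j k"
      using jk no_loops'[OF jk] j unfolding side_def path_between_def vpath_def
      by (intro CollectI exI[of _ "[j]"]) auto
    have "path_prod R p = mat (m i) (\<rho> (j, k)) (\<lambda>(a, l). T $$ (offset m i + a, y j k l)) *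
        mat (\<rho> (j, k)) (n j) (\<lambda>(l, b). g j k l (offset n j + b))"
      unfolding path_prod_def p' out[OF p[unfolded p']] by (simp add: R_def)
    also have "\<dots> = mat (m i) (n j) (\<lambda>(a, b). T $$ (offset m i + a, offset n j + b))"
    proof (rule mat_mult_eqI)
      fix a b assume a: "a < m i" and b: "b < n j"
      show "T $$ (offset m i + a, offset n j + b) =
          (\<Sum>l<\<rho> (j, k). T $$ (offset m i + a, y j k l) * g j k l (offset n j + b))"
      proof (rule g[OF jk])
        show "offset m i + a < dim_row T"
          using offset_less[of i K a m] i a by (simp add: verts_eq dim_row_eq)
        show "offset n j + b < dim_col T"
          using offset_less[of j K b n] j b by (simp add: verts_eq dim_col_eq)
        show "offset m i + a \<in> block_indices m (side G k j)"
          using end_in_side[OF p[unfolded p']] a by (auto simp: block_indices_offset)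
        show "offset n j + b \<in> block_indices n (side G j k)"
          using \<open>j \<in> side G j k\<close> b by (auto simp: block_indices_offset)
      qed
    qed
    also have "\<dots> = block_submatrix m n T {i} {j}" by (rule block_eq_mat[OF i j, symmetric])
    finally show ?thesis ..
  qed
  then have "tqs_representation G m n T \<rho> R"
    unfolding tqs_representation_def
    by (intro conjI allI ballI impI) (simp_all add: R_def block_eq_mat)
  then show ?thesis ..
qed

end

theorem theorem4p4:
  fixes G :: "nat pair_pre_digraph" and K r :: nat and m n :: "nat \<Rightarrow> nat"
    and T :: "('a :: field) mat" and \<rho> :: "nat \<times> nat \<Rightarrow> nat"
  assumes "undirected_tree G"
    and "graph_partitioned_matrix K G m n T"
    and "r \<in> pverts G"
    and "\<And>e. e \<in> parcs G \<Longrightarrow> \<rho> e = mat_rank (unit_hankel_block G r m n T e)"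
  shows "(\<exists>R. tqs_representation G m n T \<rho> R) \<and>
    (\<forall>R. tqs_representation G m n T \<rho> R \<longrightarrow> minimal_tqs_representation G m n T \<rho> R)"
proof -
  interpret partitioned_tree G K m n T
    using assms(1,2) by (simp add: partitioned_tree_def partitioned_tree_axioms_def tree_graph_iff)
  have "\<rho> e \<le> \<rho>' e" if "tqs_representation G m n T \<rho>' R'" "e \<in> parcs G" for \<rho>' R' e
    using rank_unit_hankel_block_le[OF assms(3) _ that(1)] that(2) assms(4) by (cases e) auto
  then show ?thesis
    using tqs_representation_exists[OF assms(3,4)] by (auto simp: minimal_tqs_representation_def)
qed

end
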